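(* Let $S_1,S_2\subset\mathbb{R}$. Suppose $(b_i)_{i\ge1}$ and $(d_j)_{j\ge1}$ are lacunary sequences in $(0,\infty)$ with all $b_i\in S_1$ and all $d_j\in S_2$, and let $I(W)=\#\{i: b_i\ge e^{-W}\}$ and $J(W)=\#\{j: d_j\ge e^{-W}\}$ be their counting functions. If $$\limsup_{W\to\infty}\frac{I(W)\,J(W)}{W}=\infty,$$ then $S_1+S_2$ is not measure universal. The same conclusion holds for $S_1-S_2$, i.e. $S_1-S_2$ is not measure universal.
   Context: A set $E\subset\mathbb{R}$ is measure universal if for every Lebesgue measurable $L\subset\mathbb{R}$ of positive Lebesgue measure there exist $x\in\mathbb{R}$ and $\lambda\neq0$ with $x+\lambda E\subset L$. A sequence $(b_i)_{i\ge1}\subset(0,\infty)$ is lacunary with ratio $q\in(0,1)$ if $b_{i+1}\le q\,b_i$ for all $i$; it is lacunary if this holds for some $q\in(0,1)$ (the two sequences may have different ratios). Counting functions are defined for $W>0$. $S_1\pm S_2=\{s_1\pm s_2: s_1\in S_1,\ s_2\in S_2\}$. $\log$ is the natural logarithm. *)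

theory Defs
  imports "HOL-Analysis.Analysis"
begin

(* Positivity of the measure is stated with emeasure: the real-valued
   measure sends sets of infinite measure to 0. *)
definition measure_universal :: "real set \<Rightarrow> bool" where
  "measure_universal E \<longleftrightarrow>
     (\<forall>L \<in> sets lebesgue. emeasure lebesgue L > 0 \<longrightarrow>
        (\<exists>x c. c \<noteq> 0 \<and> (\<lambda>e. x + c * e) ` E \<subseteq> L))"

(* Sequences are indexed from 0 instead of 1. *)
definition lacunary_with_ratio :: "real \<Rightarrow> (nat \<Rightarrow> real) \<Rightarrow> bool" where
  "lacunary_with_ratio q b \<longleftrightarrow>
     0 < q \<and> q < 1 \<and> (\<forall>i. 0 < b i) \<and> (\<forall>i. b (Suc i) \<le> q * b i)"

definition lacunary :: "(nat \<Rightarrow> real) \<Rightarrow> bool" where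
  "lacunary b \<longleftrightarrow> (\<exists>q. lacunary_with_ratio q b)"

definition counting :: "(nat \<Rightarrow> real) \<Rightarrow> real \<Rightarrow> nat" where
  "counting b W = card {i. b i \<ge> exp (- W)}"

(* Hence the cardinality in counting is never the default value of an infinite set. *)
lemma lacunary_finite_counting:
  assumes "lacunary b"
  shows "finite {i. b i \<ge> exp (- W)}"
proof -
  obtain q where q: "0 < q" "q < 1" and step: "\<And>i. b (Suc i) \<le> q * b i"
    using assms unfolding lacunary_def lacunary_with_ratio_def by blast
  have bound: "b i \<le> q ^ i * b 0" for i
  proof (induction i)
    case (Suc i)
    have "b (Suc i) \<le> q * b i" by (rule step)
    also have "\<dots> \<le> q * (q ^ i * b 0)" using Suc q by (intro mult_left_mono) auto
    finally show ?case by (simp add: mult.assoc)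
  qed simp
  have "(\<lambda>i. q ^ i * b 0) \<longlonglongrightarrow> 0 * b 0"
    using q by (intro tendsto_mult LIMSEQ_realpow_zero tendsto_const) auto
  then have "\<forall>\<^sub>F i in sequentially. q ^ i * b 0 < exp (- W)"
    by (intro order_tendstoD(2)) auto
  then obtain N where N: "\<And>i. i \<ge> N \<Longrightarrow> q ^ i * b 0 < exp (- W)"
    unfolding eventually_sequentially by blast
  have "{i. b i \<ge> exp (- W)} \<subseteq> {..<N}"
  proof
    fix i assume "i \<in> {i. b i \<ge> exp (- W)}"
    then have "exp (- W) \<le> q ^ i * b 0" using bound[of i] by simp
    then show "i \<in> {..<N}" using N[of i] by (cases "i < N") auto
  qed
  then show ?thesis using finite_subset by blast
qed

end

theory Submission
  imports Defs
begin

text \<open>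
  The first ingredient is a version of a criterion of Kolountzakis: \<open>E\<close> is not measure universal if it has
  bounded finite subsets \<open>A\<close> with gaps at least \<open>exp (- W)\<close> and \<open>card A / W\<close> arbitrarily large. Cut \<open>[0, 1]\<close>
  into \<open>N\<close> cells with \<open>N\<close> of order \<open>exp W\<close>. For scales in \<open>[1/m, m]\<close> an affine copy of \<open>A\<close> meets \<open>card A\<close>
  distinct cells, up to rounding, and only \<open>N ^ 8\<close> such patterns occur, so a greedy choice of about
  \<open>N ln N / card A\<close> cells meets all of them. Their total length is \<open>O(W / card A)\<close>; removing such sets for
  every \<open>m\<close> with summable small lengths leaves a set of positive measure without affine copies of \<open>E\<close>.

  After passing to subsequences of ratio \<open>1/16\<close>, the \<open>I(W) J(W)\<close> values \<open>b i \<plusminus> d j\<close> satisfy this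
  criterion: pairs in which one term is at most a quarter of the other have values separated by
  \<open>exp (- W) / 2\<close> within each of the two classes, and the remaining pairs number at most \<open>I(W) = O(W)\<close>.
\<close>

section \<open>Hitting sets\<close>

text \<open>By double counting, some element of \<open>U\<close> lies in at least the fraction
  \<open>n / card U\<close> of the sets not met so far. Adding it to \<open>T\<close> shrinks their
  number by the factor \<open>1 - n / card U\<close>.\<close>

lemma greedy_hitting_set:
  fixes F :: "'a set set"
  assumes "finite U" "finite F" and F: "\<And>S. S \<in> F \<Longrightarrow> S \<subseteq> U \<and> n \<le> card S"
  shows "\<exists>T\<subseteq>U. card T \<le> t \<and>
           real (card {S \<in> F. S \<inter> T = {}}) \<le> real (card F) * (1 - real n / real (card U)) ^ t"
proof (induction t)
  case 0
  then show ?case by (intro exI[of _ "{}"]) auto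
next
  case (Suc t)
  then obtain T where T: "T \<subseteq> U" "card T \<le> t"
    and le: "real (card {S \<in> F. S \<inter> T = {}}) \<le> real (card F) * (1 - real n / real (card U)) ^ t"
    by blast
  let ?G = "{S \<in> F. S \<inter> T = {}}"
  have fG: "finite ?G" using \<open>finite F\<close> by simp
  show ?case
  proof (cases "U = {} \<or> F = {}")
    case True
    \<comment> \<open>Keeping \<open>T\<close> is enough: if \<open>U = {}\<close>, the quotient is
      0 by the convention for division by 0 and the bound does not change with \<open>t\<close>; if
      \<open>F = {}\<close>, both sides are 0.\<close>
    then show ?thesis using T le by (intro exI[of _ T]) auto
  next
    case False
    then have cU: "card U > 0" using \<open>finite U\<close> by (auto simp: card_gt_0_iff)
    obtain S0 where "S0 \<in> F" using False by blast
    \<comment> \<open>This makes the factor \<open>1 - n / card U\<close> nonnegative, so the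
      induction hypothesis may be multiplied by it.\<close>
    then have "n \<le> card U" using F[of S0] card_mono[OF \<open>finite U\<close>, of S0] by linarith
    have double: "(\<Sum>u\<in>U. card {S \<in> ?G. u \<in> S}) = (\<Sum>S\<in>?G. card {u \<in> U. u \<in> S})"
    proof -
      have "(\<Sum>u\<in>U. card {S \<in> ?G. u \<in> S}) = (\<Sum>u\<in>U. \<Sum>S\<in>{S \<in> ?G. u \<in> S}. 1)"
        by simp
      also have "\<dots> = (\<Sum>S\<in>?G. \<Sum>u\<in>{u \<in> U. u \<in> S}. 1)"
        by (rule sum.swap_restrict[OF \<open>finite U\<close> fG])
      finally show ?thesis by simp
    qed
    have "card ?G * n \<le> (\<Sum>S\<in>?G. card {u \<in> U. u \<in> S})"
    proof -
      have "n \<le> card {u \<in> U. u \<in> S}" if "S \<in> ?G" for S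
      proof -
        have "{u \<in> U. u \<in> S} = S" using F that by blast
        then show ?thesis using F that by auto
      qed
      then show ?thesis using sum_bounded_below[of ?G n] by auto
    qed
    then have ge: "card ?G * n \<le> (\<Sum>u\<in>U. card {S \<in> ?G. u \<in> S})" using double by simp
    have "\<exists>u\<in>U. card ?G * n \<le> card {S \<in> ?G. u \<in> S} * card U"
    proof (rule ccontr)
      assume "\<not> ?thesis"
      then have "(\<Sum>u\<in>U. card {S \<in> ?G. u \<in> S} * card U) < (\<Sum>u\<in>U. card ?G * n)"
        using False \<open>finite U\<close> by (intro sum_strict_mono) (auto simp: not_le)
      then have "(\<Sum>u\<in>U. card {S \<in> ?G. u \<in> S}) * card U < card ?G * n * card U"
        by (simp only: sum_distrib_left sum_distrib_right sum_constant of_nat_id mult_ac)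
      then show False using ge by simp
    qed
    then obtain u where u: "u \<in> U" "card ?G * n \<le> card {S \<in> ?G. u \<in> S} * card U" by blast
    have eq: "{S \<in> F. S \<inter> insert u T = {}} = ?G - {S \<in> ?G. u \<in> S}" by auto
    have sub: "{S \<in> ?G. u \<in> S} \<subseteq> ?G" by blast
    have "real (card {S \<in> F. S \<inter> insert u T = {}}) = real (card ?G) - real (card {S \<in> ?G. u \<in> S})"
    proof -
      have fin: "finite {S \<in> ?G. u \<in> S}" using sub fG by (rule finite_subset)
      have "card {S \<in> ?G. u \<in> S} \<le> card ?G" using fG sub by (rule card_mono)
      moreover have "card {S \<in> F. S \<inter> insert u T = {}} = card ?G - card {S \<in> ?G. u \<in> S}"
        by (rule trans[OF arg_cong[OF eq, of card] card_Diff_subset[OF fin sub]])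
      ultimately show ?thesis by (simp only: of_nat_diff)
    qed
    also have "\<dots> \<le> real (card ?G) * (1 - real n / real (card U))"
    proof -
      have "real (card ?G) * real n \<le> real (card {S \<in> ?G. u \<in> S}) * real (card U)"
        using of_nat_mono[OF u(2), where 'a = real] by (simp only: of_nat_mult)
      moreover have "g - h \<le> g * (1 - real n / real (card U))" if "g * real n \<le> h * real (card U)" for g h
        using that cU by (simp add: field_simps)
      ultimately show ?thesis by blast
    qed
    also have "\<dots> \<le> real (card F) * (1 - real n / real (card U)) ^ t * (1 - real n / real (card U))"
      using le \<open>n \<le> card U\<close> cU by (intro mult_right_mono) auto
    finally have "real (card {S \<in> F. S \<inter> insert u T = {}})
        \<le> real (card F) * (1 - real n / real (card U)) ^ Suc t"
      by (simp add: mult_ac)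
    moreover have "card (insert u T) \<le> Suc t"
      using T(2) card_insert_le_m1[of "Suc t" T u] by simp
    ultimately show ?thesis using u(1) T(1) by (intro exI[of _ "insert u T"]) auto
  qed
qed

text \<open>With \<open>q = n / card U\<close>, at most
  \<open>exp B * (1 - q) ^ t \<le> exp (B - q * t)\<close> sets remain unmet after \<open>t\<close>
  greedy choices. For \<open>t > B / q\<close> this is below 1, and a cardinality below 1 is
  0.\<close>

corollary small_hitting_set:
  fixes F :: "'a set set"
  assumes "finite U" "finite F" and F: "\<And>S. S \<in> F \<Longrightarrow> S \<subseteq> U \<and> n \<le> card S"
    and "real (card F) \<le> exp B" and "0 \<le> B" and "0 < n"
  shows "\<exists>T\<subseteq>U. real (card T) \<le> real (card U) * B / real n + 1 \<and> (\<forall>S\<in>F. S \<inter> T \<noteq> {})"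
proof (cases "F = {}")
  case True
  then show ?thesis using assms by (intro exI[of _ "{}"]) auto
next
  case False
  then obtain S0 where "S0 \<in> F" by blast
  then have "n \<le> card U" using F[of S0] card_mono[OF \<open>finite U\<close>, of S0] by linarith
  define q where "q = real n / real (card U)"
  have q: "0 < q" "q \<le> 1" using \<open>n \<le> card U\<close> \<open>0 < n\<close> by (auto simp: q_def)
  define t where "t = nat \<lfloor>B / q\<rfloor> + 1"
  have "B / q \<ge> 0" using q \<open>0 \<le> B\<close> by simp
  then have t: "B / q < real t" "real t \<le> B / q + 1" unfolding t_def by linarith+
  obtain T where T: "T \<subseteq> U" "card T \<le> t"
    and le: "real (card {S \<in> F. S \<inter> T = {}}) \<le> real (card F) * (1 - q) ^ t"
    using greedy_hitting_set[OF \<open>finite U\<close> \<open>finite F\<close> F, where t = t] unfolding q_def by blast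
  have "(1 - q) ^ t \<le> exp (- q) ^ t"
    using q exp_ge_add_one_self[of "- q"] by (intro power_mono) auto
  then have "real (card F) * (1 - q) ^ t \<le> exp B * exp (- q) ^ t"
    using q assms(4) by (intro mult_mono) auto
  also have "\<dots> = exp (B - q * real t)"
    by (simp add: exp_diff exp_minus field_simps flip: exp_of_nat_mult)
  also have "\<dots> < 1" using t(1) q by (simp add: field_simps)
  finally have "card {S \<in> F. S \<inter> T = {}} = 0" using le by linarith
  then have "\<forall>S\<in>F. S \<inter> T \<noteq> {}" using \<open>finite F\<close> by auto
  moreover have "real (card T) \<le> real (card U) * B / real n + 1"
  proof -
    have "B / q = real (card U) * B / real n" by (simp add: q_def)
    then show ?thesis using T(2) t(2) by linarith
  qed
  ultimately show ?thesis using T(1) by blast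
qed


section \<open>Avoiding sets with large separated subsets\<close>

text \<open>\<open>W\<close> is the logarithmic resolution of \<open>A\<close>. The bound
  \<open>M\<close> is common to all \<open>K\<close>, so that the error of rounding an affine map on
  \<open>A\<close> is controlled before \<open>A\<close> is chosen.\<close>

definition has_separated_subsets :: "real set \<Rightarrow> real \<Rightarrow> bool" where
  "has_separated_subsets E M \<longleftrightarrow>
    (\<forall>K. \<exists>A W. A \<subseteq> E \<and> finite A \<and> (\<forall>a\<in>A. \<bar>a\<bar> \<le> M) \<and> 1 \<le> W \<and>
      K * W \<le> real (card A) \<and> pairwise (\<lambda>a a'. exp (- W) \<le> \<bar>a - a'\<bar>) A)"

text \<open>
  The pair \<open>(p, r)\<close> encodes the affine map with coefficients rounded to multiples of \<open>1 / N\<^sup>2\<close>.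
\<close>
definition grid_cell :: "nat \<Rightarrow> int \<times> int \<Rightarrow> real \<Rightarrow> int" where
  "grid_cell N = (\<lambda>(p, r) a.
    \<lfloor>real N * (real_of_int p / (real N)\<^sup>2 + real_of_int r / (real N)\<^sup>2 * a)\<rfloor>)"

text \<open>Rounding \<open>x\<close> and \<open>c\<close> to multiples of \<open>1 / N ^ 2\<close>
  moves each point by at most \<open>(1 + M) / N ^ 2 \<le> 1 / N\<close>, and passing to the left
  end of its cell costs another \<open>1 / N\<close>. The rounded slope is still at least
  \<open>1 / (2 * m)\<close> in absolute value, so a gap \<open>exp (- W)\<close> becomes at least
  one cell width and distinct points get distinct cells.\<close>

lemma grid_cell_approximation:
  fixes A :: "real set" and N :: nat and x c m M W :: real
  assumes "finite A" "A \<noteq> {}" "\<forall>a\<in>A. \<bar>a\<bar> \<le> M" "pairwise (\<lambda>a a'. exp (- W) \<le> \<bar>a - a'\<bar>) A"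
    and m: "1 \<le> m" "1 / m \<le> \<bar>c\<bar>" "\<bar>c\<bar> \<le> m" and x: "\<forall>a\<in>A. 0 \<le> x + c * a \<and> x + c * a \<le> 1"
    and N: "2 + M + m * M \<le> real N" "1 + m \<le> real N" "2 * m * exp W \<le> real N"
    and "0 \<le> M" "1 \<le> W"
  obtains p r where "\<bar>p\<bar> \<le> int N ^ 3" "\<bar>r\<bar> \<le> int N ^ 3" "inj_on (grid_cell N (p, r)) A"
    "grid_cell N (p, r) ` A \<subseteq> {-1..int N + 1}"
    "\<forall>a\<in>A. \<bar>x + c * a - real_of_int (grid_cell N (p, r) a) / real N\<bar> \<le> 2 / real N"
proof -
  define R where "R = real N"
  have R: "2 \<le> R" "2 + M + m * M \<le> R" "1 + m \<le> R" "2 * m * exp W \<le> R"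
    using N m by (auto simp: R_def)
  have "1 \<le> exp W" using \<open>1 \<le> W\<close> by simp
  have R2m: "2 * m \<le> R" using R(4) m(1) \<open>1 \<le> exp W\<close> mult_left_mono[of 1 "exp W" "2 * m"] by linarith
  have R2: "R \<le> R\<^sup>2" "0 < R\<^sup>2" "1 \<le> R\<^sup>2" using R(1) one_le_power[of R 2] by (auto simp: power2_eq_square)
  define p where "p = \<lfloor>R\<^sup>2 * x\<rfloor>"
  define r where "r = \<lfloor>R\<^sup>2 * c\<rfloor>"
  define x' where "x' = real_of_int p / R\<^sup>2"
  define c' where "c' = real_of_int r / R\<^sup>2"
  have close: "\<bar>x - x'\<bar> \<le> 1 / R\<^sup>2" "\<bar>c - c'\<bar> \<le> 1 / R\<^sup>2"
  proof -
    have "\<bar>R\<^sup>2 * x - p\<bar> \<le> 1" "\<bar>R\<^sup>2 * c - r\<bar> \<le> 1" unfolding p_def r_def by linarith+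
    moreover have "x - x' = (R\<^sup>2 * x - p) / R\<^sup>2" "c - c' = (R\<^sup>2 * c - r) / R\<^sup>2"
      using R2 by (auto simp: x'_def c'_def field_simps)
    ultimately show "\<bar>x - x'\<bar> \<le> 1 / R\<^sup>2" "\<bar>c - c'\<bar> \<le> 1 / R\<^sup>2"
      using R2 by (auto simp: divide_right_mono)
  qed
  have f: "grid_cell N (p, r) a = \<lfloor>R * (x' + c' * a)\<rfloor>" for a
    by (simp add: grid_cell_def x'_def c'_def R_def)
  have near: "\<bar>(x + c * a) - (x' + c' * a)\<bar> \<le> 1 / R" if "a \<in> A" for a
  proof -
    have "(x + c * a) - (x' + c' * a) = (x - x') + (c - c') * a" by (simp add: algebra_simps)
    also have "\<bar>\<dots>\<bar> \<le> \<bar>x - x'\<bar> + \<bar>c - c'\<bar> * \<bar>a\<bar>" by (metis abs_mult abs_triangle_ineq)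
    also have "\<dots> \<le> 1 / R\<^sup>2 + 1 / R\<^sup>2 * M"
      using close assms(3) that by (intro add_mono mult_mono) auto
    also have "\<dots> = (1 + M) / R\<^sup>2" by (simp add: add_divide_distrib)
    also have "\<dots> \<le> R / R\<^sup>2"
    proof (rule divide_right_mono)
      have "0 \<le> m * M" using m \<open>0 \<le> M\<close> by simp
      then show "1 + M \<le> R" using R(2) by linarith
    qed simp
    finally show ?thesis using R(1) by (simp add: power2_eq_square)
  qed
  have cube: "R ^ 3 = R\<^sup>2 * R" by (simp add: power2_eq_square power3_eq_cube)
  \<comment> \<open>A single point of the copy in \<open>[0, 1]\<close> bounds the translation by
    \<open>1 + m * M\<close>, hence \<open>p\<close> by \<open>N ^ 3\<close>.\<close>
  obtain a0 where a0: "a0 \<in> A" using \<open>A \<noteq> {}\<close> by blast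
  have "\<bar>c * a0\<bar> \<le> m * M" unfolding abs_mult using m assms(3) a0 by (intro mult_mono) auto
  then have "\<bar>x\<bar> \<le> 1 + m * M" using x a0 by (smt (verit))
  then have "R\<^sup>2 * \<bar>x\<bar> \<le> R\<^sup>2 * (1 + m * M)" by (intro mult_left_mono) auto
  then have "\<bar>R\<^sup>2 * x\<bar> \<le> R\<^sup>2 * (1 + m * M)" by (simp add: abs_mult)
  then have "\<bar>real_of_int p\<bar> \<le> R\<^sup>2 * (1 + m * M) + 1" unfolding p_def by linarith
  also have "\<dots> \<le> R\<^sup>2 * (1 + m * M) + R\<^sup>2 * 1" using R2 by simp
  also have "\<dots> \<le> R\<^sup>2 * R" unfolding distrib_left[symmetric]
    using R(2) \<open>0 \<le> M\<close> by (intro mult_left_mono) auto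
  finally have "\<bar>real_of_int p\<bar> \<le> real N ^ 3" by (simp add: cube flip: R_def)
  then have p: "\<bar>p\<bar> \<le> int N ^ 3"
    by (metis (mono_tags, lifting) of_int_abs of_int_le_iff of_int_of_nat_eq of_int_power)
  have "R\<^sup>2 * \<bar>c\<bar> \<le> R\<^sup>2 * m" using m by (intro mult_left_mono) auto
  then have "\<bar>R\<^sup>2 * c\<bar> \<le> R\<^sup>2 * m" by (simp add: abs_mult)
  then have "\<bar>real_of_int r\<bar> \<le> R\<^sup>2 * m + 1" unfolding r_def by linarith
  also have "\<dots> \<le> R\<^sup>2 * m + R\<^sup>2 * 1" using R2 by simp
  also have "\<dots> \<le> R\<^sup>2 * R" unfolding distrib_left[symmetric]
    using R(3) by (intro mult_left_mono) auto
  finally have "\<bar>real_of_int r\<bar> \<le> real N ^ 3" by (simp add: cube flip: R_def)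
  then have r: "\<bar>r\<bar> \<le> int N ^ 3"
    by (metis (mono_tags, lifting) of_int_abs of_int_le_iff of_int_of_nat_eq of_int_power)
  have c'_ge: "1 / (2 * m) \<le> \<bar>c'\<bar>"
  proof -
    have "1 / R\<^sup>2 \<le> 1 / (2 * m)" using R2 R2m m by (intro divide_left_mono) auto
    moreover have "1 / m = 1 / (2 * m) + 1 / (2 * m)" by simp
    ultimately show ?thesis using close(2) m(2) by linarith
  qed
  have inj: "inj_on (grid_cell N (p, r)) A"
  proof (rule inj_onI, rule ccontr)
    fix a a' assume a: "a \<in> A" "a' \<in> A" "grid_cell N (p, r) a = grid_cell N (p, r) a'" "a \<noteq> a'"
    have gap: "exp (- W) \<le> \<bar>a - a'\<bar>" using assms(4) a by (auto simp: pairwise_def)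
    \<comment> \<open>Reals at distance at least 1 cannot have the same floor.\<close>
    have "1 \<le> R * (1 / (2 * m) * exp (- W))"
      using R(4) m by (simp add: exp_minus field_simps)
    also have "\<dots> \<le> R * (\<bar>c'\<bar> * \<bar>a - a'\<bar>)"
      using c'_ge gap R(1) m by (intro mult_left_mono mult_mono) auto
    also have "\<dots> = \<bar>R * (x' + c' * a) - R * (x' + c' * a')\<bar>"
    proof -
      have "R * (x' + c' * a) - R * (x' + c' * a') = R * (c' * (a - a'))" by (simp add: algebra_simps)
      then show ?thesis using R(1) by (simp add: abs_mult)
    qed
    finally show False using a(3) unfolding f by linarith
  qed
  have rng: "grid_cell N (p, r) ` A \<subseteq> {-1..int N + 1}"
  proof safe
    fix a assume a: "a \<in> A"
    have "- (1 / R) \<le> x' + c' * a" "x' + c' * a \<le> 1 + 1 / R"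
      using near[OF a] x a by (smt (verit))+
    then have *: "R * (- (1 / R)) \<le> R * (x' + c' * a)" "R * (x' + c' * a) \<le> R * (1 + 1 / R)"
      using R(1) mult_left_mono[of "- (1 / R)" "x' + c' * a" R] mult_left_mono[of "x' + c' * a" "1 + 1 / R" R]
      by linarith+
    have "- 1 \<le> R * (x' + c' * a)" "R * (x' + c' * a) \<le> R + 1"
    proof -
      have "R * (- (1 / R)) = - 1" "R * (1 + 1 / R) = R + 1" using R(1) by (auto simp: distrib_left)
      then show "- 1 \<le> R * (x' + c' * a)" "R * (x' + c' * a) \<le> R + 1" using * by linarith+
    qed
    then show "grid_cell N (p, r) a \<in> {-1..int N + 1}" unfolding f R_def atLeastAtMost_iff by linarith
  qed
  have fin: "\<forall>a\<in>A. \<bar>x + c * a - real_of_int (grid_cell N (p, r) a) / real N\<bar> \<le> 2 / real N"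
  proof
    fix a assume "a \<in> A"
    have "\<bar>R * (x' + c' * a) - grid_cell N (p, r) a\<bar> \<le> 1" unfolding f by linarith
    moreover have "(x' + c' * a) - grid_cell N (p, r) a / R = (R * (x' + c' * a) - grid_cell N (p, r) a) / R"
      using R(1) by (simp add: field_simps)
    ultimately have "\<bar>(x' + c' * a) - grid_cell N (p, r) a / R\<bar> \<le> 1 / R"
      using R(1) by (auto simp: divide_right_mono)
    moreover have "2 / R = 1 / R + 1 / R" by simp
    ultimately show "\<bar>x + c * a - real_of_int (grid_cell N (p, r) a) / real N\<bar> \<le> 2 / real N"
      unfolding R_def[symmetric] using near[OF \<open>a \<in> A\<close>] by linarith
  qed
  show ?thesis by (rule that[OF p r inj rng fin])
qed


text \<open>\<open>R\<close> consists of intervals around the grid points of a hitting set for all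
  cell patterns. Since there are at most \<open>N ^ 8\<close> patterns and
  \<open>ln N \<le> C * W\<close>, its measure is at most
  \<open>64 * C * W / card A + 4 / N\<close>; each summand is made at most
  \<open>\<epsilon> / 2\<close>.\<close>

lemma avoid_scales:
  assumes E: "has_separated_subsets E M" and "0 \<le> M" "1 \<le> m" "0 < \<epsilon>"
  shows "\<exists>R \<in> lmeasurable. measure lebesgue R \<le> \<epsilon> \<and>
    (\<forall>x c. 1 / m \<le> \<bar>c\<bar> \<longrightarrow> \<bar>c\<bar> \<le> m \<longrightarrow> (\<lambda>e. x + c * e) ` E \<subseteq> {0..1} \<longrightarrow>
      (\<lambda>e. x + c * e) ` E \<inter> R \<noteq> {})"
proof -
  \<comment> \<open>\<open>D\<close> dominates every lower bound on \<open>N\<close> that the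
    rounding and the final estimate require, and it is fixed before \<open>W\<close> is
    known.\<close>
  define D where "D = 3 + 2 * m + M + m * M + 8 / \<epsilon>"
  have "0 \<le> m * M" "0 < 8 / \<epsilon>" using assms by auto
  then have D: "3 \<le> D" "2 + M + m * M \<le> D" "1 + m \<le> D" "2 * m \<le> D" "8 / \<epsilon> \<le> D"
    using assms unfolding D_def by linarith+
  \<comment> \<open>This gives \<open>ln N \<le> C * W\<close>, because
    \<open>N \<le> (D + 1) * exp W\<close> and \<open>1 \<le> W\<close>.\<close>
  define C where "C = ln (D + 1) + 1"
  have C: "0 < C" using D by (simp add: C_def add_pos_pos)
  obtain A W where A: "A \<subseteq> E" "finite A" "\<forall>a\<in>A. \<bar>a\<bar> \<le> M" "1 \<le> W"
      "128 * C / \<epsilon> * W \<le> real (card A)" "pairwise (\<lambda>a a'. exp (- W) \<le> \<bar>a - a'\<bar>) A"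
    using E unfolding has_separated_subsets_def by meson
  have "1 \<le> exp W" using A(4) by simp
  have "0 < 128 * C / \<epsilon> * W" using C assms A by simp
  then have n0: "0 < card A" using A(5) by linarith
  then have "A \<noteq> {}" by auto
  define N where "N = nat \<lceil>D * exp W\<rceil>"
  have "0 \<le> D * exp W" using D by simp
  then have NW: "D * exp W \<le> real N" "real N \<le> D * exp W + 1" unfolding N_def by linarith+
  have "D \<le> D * exp W" using D \<open>1 \<le> exp W\<close> mult_left_mono[of 1 "exp W" D] by simp
  then have ND: "D \<le> real N" using NW by linarith
  have N2: "2 * m * exp W \<le> real N" by (rule order_trans[OF mult_right_mono[OF D(4)] NW(1)]) simp
  have N3: "3 \<le> N" using ND D by linarith
  have lnN: "ln (real N) \<le> C * W"
  proof -
    have "real N \<le> (D + 1) * exp W"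
      using NW(2) \<open>1 \<le> exp W\<close> unfolding distrib_right by linarith
    then have "ln (real N) \<le> ln ((D + 1) * exp W)" using N3 by (subst ln_le_cancel_iff) auto
    also have "\<dots> = ln (D + 1) + W" using D by (simp add: ln_mult)
    also have "\<dots> \<le> ln (D + 1) * W + W"
      using D A(4) mult_left_mono[of 1 W "ln (D + 1)"] by simp
    finally show ?thesis by (simp add: C_def distrib_right)
  qed
  define U where "U = {-1..int N + 1}"
  define I where "I = {- (int N ^ 3)..int N ^ 3}"
  \<comment> \<open>The filter keeps exactly the patterns that lie in the \<open>N + 3\<close> cells
    of \<open>U\<close> and have full size; by \<open>grid_cell_approximation\<close> every copy to
    be met yields one of them.\<close>
  define F where "F = {S \<in> (\<lambda>pr. grid_cell N pr ` A) ` (I \<times> I). S \<subseteq> U \<and> card A \<le> card S}"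
  have "finite I" "finite U" by (auto simp: I_def U_def)
  then have "finite F" by (auto simp: F_def)
  have cU: "real (card U) \<le> 2 * real N" using N3 by (simp add: U_def)
  have "card F \<le> card I * card I"
  proof -
    have "card F \<le> card ((\<lambda>pr. grid_cell N pr ` A) ` (I \<times> I))"
      using \<open>finite I\<close> by (auto simp: F_def intro!: card_mono)
    also have "\<dots> \<le> card (I \<times> I)" using \<open>finite I\<close> by (intro card_image_le) auto
    finally show ?thesis by (simp add: card_cartesian_product)
  qed
  moreover have "card I \<le> N ^ 4"
  proof -
    have "card I = 2 * N ^ 3 + 1"
      by (simp add: I_def nat_add_distrib nat_mult_distrib nat_power_eq)
    also have "\<dots> \<le> 3 * N ^ 3" using N3 by simp
    also have "\<dots> \<le> N * N ^ 3" using N3 by (intro mult_right_mono) auto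
    finally show ?thesis by (simp add: power_numeral_reduce)
  qed
  ultimately have "card F \<le> N ^ 4 * N ^ 4" by (meson le_trans mult_le_mono)
  then have "card F \<le> N ^ 8" by (simp flip: power_add)
  then have "real (card F) \<le> real N ^ 8" by (metis of_nat_le_iff of_nat_power)
  also have "\<dots> = exp (8 * ln (real N))" using N3 exp_of_nat_mult[of 8 "ln (real N)"] by simp
  finally have cF: "real (card F) \<le> exp (8 * ln (real N))" .
  have "\<exists>T\<subseteq>U. real (card T) \<le> real (card U) * (8 * ln (real N)) / real (card A) + 1 \<and>
      (\<forall>S\<in>F. S \<inter> T \<noteq> {})"
    by (rule small_hitting_set[OF \<open>finite U\<close> \<open>finite F\<close> _ cF _ n0]) (use N3 in \<open>auto simp: F_def\<close>)
  then obtain T where T: "T \<subseteq> U" "real (card T) \<le> real (card U) * (8 * ln (real N)) / real (card A) + 1"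
      "\<And>S. S \<in> F \<Longrightarrow> S \<inter> T \<noteq> {}"
    by blast
  have "finite T" using T(1) \<open>finite U\<close> finite_subset by blast
  \<comment> \<open>The radius \<open>2 / N\<close> is the approximation error of the grid, so
    \<open>V t\<close> contains every point of the copy that is assigned to cell
    \<open>t\<close>.\<close>
  define V where "V t = {real_of_int t / real N - 2 / real N..real_of_int t / real N + 2 / real N}" for t
  define R where "R = (\<Union>t\<in>T. V t)"
  have lR: "R \<in> lmeasurable"
    unfolding R_def V_def using \<open>finite T\<close> by (intro fmeasurable.finite_UN) auto
  have mR: "measure lebesgue R \<le> \<epsilon>"
  proof -
    have "measure lebesgue R \<le> (\<Sum>t\<in>T. measure lebesgue (V t))"
      unfolding R_def using \<open>finite T\<close> by (intro measure_UNION_le) (auto simp: V_def)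
    also have "\<dots> = real (card T) * (4 / real N)" by (simp add: V_def)
    also have "\<dots> \<le> (2 * real N * (8 * (C * W)) / real (card A) + 1) * (4 / real N)"
    proof (intro mult_right_mono)
      have "real (card U) * (8 * ln (real N)) \<le> 2 * real N * (8 * (C * W))"
        using cU lnN N3 by (intro mult_mono) auto
      then have "real (card U) * (8 * ln (real N)) / real (card A) \<le> 2 * real N * (8 * (C * W)) / real (card A)"
        by (intro divide_right_mono) auto
      then show "real (card T) \<le> 2 * real N * (8 * (C * W)) / real (card A) + 1"
        using T(2) by linarith
    qed simp
    also have "\<dots> = 64 * (C * W) / real (card A) + 4 / real N"
      using N3 by (simp add: distrib_right add_divide_distrib)
    also have "\<dots> \<le> \<epsilon> / 2 + \<epsilon> / 2"
    proof (rule add_mono)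
      show "64 * (C * W) / real (card A) \<le> \<epsilon> / 2"
        using A(5) n0 \<open>0 < \<epsilon>\<close> by (simp add: field_simps)
      have "8 / \<epsilon> \<le> real N" using D(5) ND by linarith
      then show "4 / real N \<le> \<epsilon> / 2" using N3 \<open>0 < \<epsilon>\<close> by (simp add: field_simps)
    qed
    finally show ?thesis by simp
  qed
  have hit: "(\<lambda>e. x + c * e) ` E \<inter> R \<noteq> {}"
    if c: "1 / m \<le> \<bar>c\<bar>" "\<bar>c\<bar> \<le> m" and E: "(\<lambda>e. x + c * e) ` E \<subseteq> {0..1}" for x c
  proof -
    have x: "\<forall>a\<in>A. 0 \<le> x + c * a \<and> x + c * a \<le> 1"
    proof
      fix a assume "a \<in> A"
      then have "x + c * a \<in> {0..1}" using E A(1) by blast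
      then show "0 \<le> x + c * a \<and> x + c * a \<le> 1" by simp
    qed
    have N1: "2 + M + m * M \<le> real N" "1 + m \<le> real N" using D ND by linarith+
    obtain p r where pr: "\<bar>p\<bar> \<le> int N ^ 3" "\<bar>r\<bar> \<le> int N ^ 3" "inj_on (grid_cell N (p, r)) A"
        "grid_cell N (p, r) ` A \<subseteq> {-1..int N + 1}"
        "\<forall>a\<in>A. \<bar>x + c * a - real_of_int (grid_cell N (p, r) a) / real N\<bar> \<le> 2 / real N"
      by (rule grid_cell_approximation[OF A(2) \<open>A \<noteq> {}\<close> A(3) A(6) \<open>1 \<le> m\<close> c x N1 N2 \<open>0 \<le> M\<close> A(4)])
        (rule that)
    have "grid_cell N (p, r) ` A \<in> F"
      unfolding F_def
    proof (intro CollectI conjI imageI)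
      show "(p, r) \<in> I \<times> I" using pr(1,2) unfolding I_def by auto
      show "grid_cell N (p, r) ` A \<subseteq> U" using pr(4) unfolding U_def .
      show "card A \<le> card (grid_cell N (p, r) ` A)" using card_image[OF pr(3)] by simp
    qed
    then obtain a where a: "a \<in> A" "grid_cell N (p, r) a \<in> T" using T(3) by blast
    have "x + c * a \<in> R"
      unfolding R_def V_def using bspec[OF pr(5) a(1)]
      by (intro UN_I[OF a(2)]) (simp only: atLeastAtMost_iff abs_le_iff, linarith)
    moreover have "x + c * a \<in> (\<lambda>e. x + c * e) ` E" using a(1) A(1) by blast
    ultimately show ?thesis by blast
  qed
  show ?thesis
  proof (intro bexI[of _ R] conjI allI impI)
    show "R \<in> lmeasurable" by (rule lR)
    show "measure lebesgue R \<le> \<epsilon>" by (rule mR)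
  qed (rule hit)
qed

text \<open>Removing from \<open>[0, 1]\<close> exceptional sets \<open>R k\<close> for the scales
  in \<open>[1 / (k + 1), k + 1]\<close>, of total measure at most \<open>1 / 2\<close>, leaves a
  set \<open>L\<close> of measure at least \<open>1 / 2\<close>. Every nonzero scale belongs to one
  of these ranges, so a copy inside \<open>L\<close> would meet some \<open>R k\<close>.\<close>

lemma has_separated_subsets_not_universal:
  assumes E: "has_separated_subsets E M" and "0 \<le> M"
  shows "\<not> measure_universal E"
proof -
  define P where "P k R \<longleftrightarrow> R \<in> lmeasurable \<and> measure lebesgue R \<le> (1/2) ^ k / 4 \<and>
    (\<forall>x c. 1 / real (Suc k) \<le> \<bar>c\<bar> \<longrightarrow> \<bar>c\<bar> \<le> real (Suc k) \<longrightarrow> (\<lambda>e. x + c * e) ` E \<subseteq> {0..1} \<longrightarrow>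
      (\<lambda>e. x + c * e) ` E \<inter> R \<noteq> {})" for k :: nat and R
  have "\<exists>R. P k R" for k
  proof -
    have k: "1 \<le> real (Suc k)" "0 < (1/2::real) ^ k / 4" by simp_all
    show ?thesis using avoid_scales[OF E \<open>0 \<le> M\<close> k] unfolding P_def Bex_def .
  qed
  then obtain R where P: "\<And>k. P k (R k)" by metis
  then have R: "\<And>k. R k \<in> lmeasurable" "\<And>k. measure lebesgue (R k) \<le> (1/2) ^ k / 4"
    unfolding P_def by blast+
  \<comment> \<open>A uniform bound on the partial unions gives both finite measure and the same
    bound for the full union.\<close>
  have bound: "measure lebesgue (\<Union>i\<le>n. R i) \<le> 1 / 2" for n
  proof -
    have "measure lebesgue (\<Union>i\<le>n. R i) \<le> (\<Sum>i\<le>n. measure lebesgue (R i))"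
      using R(1) by (intro measure_UNION_le) auto
    also have "\<dots> \<le> (\<Sum>i\<le>n. (1/2) ^ i / 4)" using R(2) by (rule sum_mono)
    also have "\<dots> = 1 / 2 - (1/2) ^ n / 4" by (induction n) auto
    also have "\<dots> \<le> 1 / 2" by simp
    finally show ?thesis .
  qed
  define L where "L = {0..1} - (\<Union>k. R k)"
  have UR: "(\<Union>k. R k) \<in> lmeasurable" "measure lebesgue (\<Union>k. R k) \<le> 1 / 2"
    using fmeasurable_countable_Union[OF R(1) bound] measure_countable_Union_le[OF R(1) bound] by auto
  have I: "{0..1::real} \<in> lmeasurable" by simp
  have "{0..1::real} \<subseteq> L \<union> (\<Union>k. R k)" by (auto simp: L_def)
  moreover have Lm: "L \<in> lmeasurable" unfolding L_def using I UR(1) by (rule fmeasurable.Diff)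
  ultimately have "measure lebesgue {0..1::real} \<le> measure lebesgue (L \<union> (\<Union>k. R k))"
    using UR(1) by (intro measure_mono_fmeasurable) auto
  also have "\<dots> \<le> measure lebesgue L + measure lebesgue (\<Union>k. R k)"
    using Lm UR(1) by (intro measure_Un_le) auto
  finally have "measure lebesgue L \<ge> 1 / 2" using UR(2) by simp
  then have pos: "emeasure lebesgue L > 0"
    using Lm by (simp add: emeasure_eq_measure2)
  show ?thesis
  proof
    assume "measure_universal E"
    then obtain x c where c: "c \<noteq> 0" "(\<lambda>e. x + c * e) ` E \<subseteq> L"
      using Lm pos unfolding measure_universal_def by blast
    define k where "k = nat \<lceil>max \<bar>c\<bar> (1 / \<bar>c\<bar>)\<rceil>"
    have "max \<bar>c\<bar> (1 / \<bar>c\<bar>) \<le> real (Suc k)" unfolding k_def by linarith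
    then have k: "\<bar>c\<bar> \<le> real (Suc k)" "1 / \<bar>c\<bar> \<le> real (Suc k)" by simp_all
    have "1 / real (Suc k) \<le> \<bar>c\<bar>" using k(2) c(1) by (simp add: field_simps)
    then have "(\<lambda>e. x + c * e) ` E \<inter> R k \<noteq> {}" using P[of k] k(1) c(2) unfolding P_def L_def by blast
    then show False using c(2) by (auto simp: L_def)
  qed
qed


section \<open>Combinations of lacunary sequences\<close>

lemma lacunary_antimono:
  assumes "lacunary_with_ratio q b"
  shows "antimono b"
proof (rule antimonoI[OF lift_Suc_antimono_le])
  have q: "q < 1" and pos: "\<And>i. 0 < b i" and step: "\<And>i. b (Suc i) \<le> q * b i"
    using assms unfolding lacunary_with_ratio_def by auto
  show "b (Suc k) \<le> b k" for k
    using step[of k] q pos[of k] mult_right_mono[of q 1 "b k"] by linarith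
qed

lemma lacunary_less:
  assumes "lacunary_with_ratio q b" "i < j"
  shows "b j \<le> q * b i"
proof -
  have "b j \<le> b (Suc i)"
    using lacunary_antimono[OF assms(1)] assms(2) by (simp add: antimono_def)
  also have "b (Suc i) \<le> q * b i" using assms(1) unfolding lacunary_with_ratio_def by auto
  finally show ?thesis .
qed

text \<open>If \<open>i < i'\<close>, the term \<open>b i\<close> dominates: the others are at most
  \<open>b i / 16\<close>, \<open>b i / 4\<close> and \<open>b i / 64\<close>, which leaves more
  than \<open>b i / 2\<close>. If \<open>i = i'\<close>, the terms of \<open>b\<close> cancel and
  \<open>d j - d j' \<ge> 15 / 16 * d j\<close> remains.\<close>

lemma pair_gap_less:
  fixes b d :: "nat \<Rightarrow> real"
  assumes b: "lacunary_with_ratio (1/16) b" and d: "lacunary_with_ratio (1/16) d" and "\<sigma> = 1 \<or> \<sigma> = - 1"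
    and "d j \<le> b i / 4" "d j' \<le> b i' / 4" "e \<le> b i" "e \<le> d j" "i < i' \<or> i = i' \<and> j < j'"
  shows "e / 2 \<le> \<bar>(b i + \<sigma> * d j) - (b i' + \<sigma> * d j')\<bar>"
proof -
  have pos: "0 < b i" "0 < b i'" "0 < d j" "0 < d j'"
    using b d unfolding lacunary_with_ratio_def by auto
  show ?thesis
  proof (cases "i < i'")
    case True
    then show ?thesis using lacunary_less[OF b True] pos assms(3-6) by auto
  next
    case False
    then have "i = i'" "j < j'" using assms(8) by auto
    then show ?thesis using lacunary_less[OF d \<open>j < j'\<close>] pos assms(3,7) by auto
  qed
qed

lemma pair_gap:
  fixes b d :: "nat \<Rightarrow> real"
  assumes "lacunary_with_ratio (1/16) b" "lacunary_with_ratio (1/16) d" "\<sigma> = 1 \<or> \<sigma> = - 1"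
    and "d j \<le> b i / 4" "e \<le> b i" "e \<le> d j"
    and "d j' \<le> b i' / 4" "e \<le> b i'" "e \<le> d j'"
    and "(i, j) \<noteq> (i', j')"
  shows "e / 2 \<le> \<bar>(b i + \<sigma> * d j) - (b i' + \<sigma> * d j')\<bar>"
proof -
  consider "i < i' \<or> i = i' \<and> j < j'" | "i' < i \<or> i' = i \<and> j' < j" using assms(10) by force
  then show ?thesis
  proof cases
    case 1
    then show ?thesis using pair_gap_less[OF assms(1-3)] assms by blast
  next
    case 2
    then have "e / 2 \<le> \<bar>(b i' + \<sigma> * d j') - (b i + \<sigma> * d j)\<bar>"
      using pair_gap_less[OF assms(1-3)] assms by blast
    then show ?thesis by (simp add: abs_minus_commute)
  qed
qed

text \<open>For fixed \<open>i\<close> the comparable terms satisfy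
  \<open>b i / 4 < d j < 4 * b i\<close>, a range of ratio 16, while distinct terms of
  \<open>d\<close> differ by a factor of at least 16. Hence each \<open>i\<close> has at most one
  partner \<open>j\<close>.\<close>

lemma card_comparable_pairs:
  assumes d: "lacunary_with_ratio (1/16) d" and "finite X"
  shows "card {(i, j) \<in> X \<times> Y. \<not> d j \<le> b i / 4 \<and> \<not> b i \<le> d j / 4} \<le> card X"
proof (rule card_inj_on_le[OF _ _ \<open>finite X\<close>])
  have False if "j < j'" "\<not> d j \<le> b i / 4" "\<not> b i \<le> d j / 4" "\<not> d j' \<le> b i / 4" "\<not> b i \<le> d j' / 4" for i j j'
    using lacunary_less[OF d that(1)] that by linarith
  then show "inj_on fst {(i, j) \<in> X \<times> Y. \<not> d j \<le> b i / 4 \<and> \<not> b i \<le> d j / 4}"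
    by (auto simp: inj_on_def) (metis linorder_neqE_nat)
qed auto

text \<open>The comparable pairs \<open>Z\<close> are discarded, and the larger of the classes
  \<open>G\<close> and \<open>H\<close> is kept. On each class \<open>pair_gap\<close> separates the
  values, with the roles of \<open>b\<close> and \<open>d\<close> exchanged on
  \<open>H\<close>.\<close>

lemma lacunary_combination_separated:
  fixes b d :: "nat \<Rightarrow> real"
  assumes b: "lacunary_with_ratio (1/16) b" and d: "lacunary_with_ratio (1/16) d" and \<sigma>: "\<sigma> = 1 \<or> \<sigma> = - 1"
    and E: "\<And>i j. b i + \<sigma> * d j \<in> E"
    and many: "\<And>K. \<exists>W\<ge>1. real (counting b W) \<le> 2 * W \<and> K * W \<le> real (counting b W) * real (counting d W)"
  shows "has_separated_subsets E (b 0 + d 0)"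
  unfolding has_separated_subsets_def
proof
  fix K
  \<comment> \<open>The summand 2 pays for the at most \<open>2 * W\<close> comparable pairs. The
    factor 4 is one factor 2 for keeping only one of \<open>G\<close> and \<open>H\<close>, and
    another for the final resolution \<open>2 * W\<close>.\<close>
  obtain W where W: "1 \<le> W" "real (counting b W) \<le> 2 * W"
      "(4 * K + 2) * W \<le> real (counting b W) * real (counting d W)"
    using many by blast
  define e where "e = exp (- W)"
  define X where "X = {i. e \<le> b i}"
  define Y where "Y = {j. e \<le> d j}"
  have "finite X" "finite Y"
    using b d lacunary_finite_counting[of _ W] unfolding X_def Y_def e_def lacunary_def by blast+
  have cX: "counting b W = card X" and cY: "counting d W = card Y"
    by (simp_all add: counting_def X_def Y_def e_def)
  define G where "G = {(i, j) \<in> X \<times> Y. d j \<le> b i / 4}"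
  define H where "H = {(i, j) \<in> X \<times> Y. b i \<le> d j / 4}"
  define Z where "Z = {(i, j) \<in> X \<times> Y. \<not> d j \<le> b i / 4 \<and> \<not> b i \<le> d j / 4}"
  have fin: "finite G" "finite H" "finite Z"
    using \<open>finite X\<close> \<open>finite Y\<close> by (auto simp: G_def H_def Z_def intro: finite_subset[OF _ finite_cartesian_product])
  have "X \<times> Y \<subseteq> (G \<union> H) \<union> Z" by (auto simp: G_def H_def Z_def)
  then have "card (X \<times> Y) \<le> card ((G \<union> H) \<union> Z)" using fin by (intro card_mono) auto
  also have "\<dots> \<le> card G + card H + card Z" using card_Un_le[of "G \<union> H" Z] card_Un_le[of G H] by linarith
  also have "card Z \<le> card X"
    unfolding Z_def using d \<open>finite X\<close> by (rule card_comparable_pairs)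
  finally have "real (card X * card Y) \<le> real (card G + card H + card X)"
    by (simp add: card_cartesian_product del: of_nat_add of_nat_mult)
  then have GH: "4 * K * W \<le> real (card G) + real (card H)"
    using W(2,3) unfolding cX cY by (simp add: distrib_right)
  define f where "f = (\<lambda>(i, j). b i + \<sigma> * d j)"
  have sep: "\<exists>A V. A \<subseteq> E \<and> finite A \<and> (\<forall>a\<in>A. \<bar>a\<bar> \<le> b 0 + d 0) \<and> 1 \<le> V \<and>
      K * V \<le> real (card A) \<and> pairwise (\<lambda>a a'. exp (- V) \<le> \<bar>a - a'\<bar>) A"
    if P: "finite P" "2 * K * W \<le> real (card P)"
      and gap: "\<And>p p'. p \<in> P \<Longrightarrow> p' \<in> P \<Longrightarrow> p \<noteq> p' \<Longrightarrow> e / 2 \<le> \<bar>f p - f p'\<bar>" for P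
  proof (intro exI conjI)
    have "0 < e" by (simp add: e_def)
    have "inj_on f P"
    proof (rule inj_onI, rule ccontr)
      fix p p' assume "p \<in> P" "p' \<in> P" "f p = f p'" "p \<noteq> p'"
      then show False using gap[of p p'] \<open>0 < e\<close> by simp
    qed
    then show "K * (2 * W) \<le> real (card (f ` P))" using P(2) by (simp add: card_image)
    show "f ` P \<subseteq> E" using E by (auto simp: f_def)
    show "finite (f ` P)" using P(1) by simp
    show "1 \<le> 2 * W" using W(1) by simp
    show "\<forall>a\<in>f ` P. \<bar>a\<bar> \<le> b 0 + d 0"
    proof safe
      fix i j
      have "0 < b i" "b i \<le> b 0" "0 < d j" "d j \<le> d 0"
        using b d antimonoD[OF lacunary_antimono[OF b], of 0 i] antimonoD[OF lacunary_antimono[OF d], of 0 j]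
        unfolding lacunary_with_ratio_def by simp_all
      then show "\<bar>f (i, j)\<bar> \<le> b 0 + d 0" using \<sigma> by (auto simp: f_def)
    qed
    \<comment> \<open>Doubling the resolution absorbs the lost factor 2 in the gap:
      \<open>exp (- (2 * W)) = e * e \<le> e / 2\<close>.\<close>
    have "2 \<le> exp W" using exp_ge_add_one_self[of W] W(1) by linarith
    then have "e \<le> 1 / 2" by (simp add: e_def exp_minus field_simps)
    then have "e * e \<le> e * (1 / 2)" using \<open>0 < e\<close> by (intro mult_left_mono) auto
    moreover have "exp (- (2 * W)) = e * e" by (simp add: e_def flip: exp_add)
    ultimately have small: "exp (- (2 * W)) \<le> e / 2" by simp
    show "pairwise (\<lambda>a a'. exp (- (2 * W)) \<le> \<bar>a - a'\<bar>) (f ` P)"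
    proof (rule pairwiseI)
      fix a a' assume "a \<in> f ` P" "a' \<in> f ` P" "a \<noteq> a'"
      then obtain p p' where "a = f p" "a' = f p'" "p \<in> P" "p' \<in> P" "p \<noteq> p'" by blast
      then show "exp (- (2 * W)) \<le> \<bar>a - a'\<bar>" using gap[of p p'] small by linarith
    qed
  qed
  consider "2 * K * W \<le> real (card G)" | "2 * K * W \<le> real (card H)" using GH by linarith
  then show "\<exists>A V. A \<subseteq> E \<and> finite A \<and> (\<forall>a\<in>A. \<bar>a\<bar> \<le> b 0 + d 0) \<and> 1 \<le> V \<and>
      K * V \<le> real (card A) \<and> pairwise (\<lambda>a a'. exp (- V) \<le> \<bar>a - a'\<bar>) A"
  proof cases
    case 1
    show ?thesis
    proof (rule sep[OF fin(1) 1])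
      fix p p' assume p: "p \<in> G" "p' \<in> G" "p \<noteq> p'"
      obtain i j i' j' where ij: "p = (i, j)" "p' = (i', j')" by fastforce
      have "e / 2 \<le> \<bar>(b i + \<sigma> * d j) - (b i' + \<sigma> * d j')\<bar>"
        using p unfolding ij by (intro pair_gap[OF b d \<sigma>]) (auto simp: G_def X_def Y_def)
      then show "e / 2 \<le> \<bar>f p - f p'\<bar>" by (simp add: f_def ij)
    qed
  next
    case 2
    show ?thesis
    proof (rule sep[OF fin(2) 2])
      fix p p' assume p: "p \<in> H" "p' \<in> H" "p \<noteq> p'"
      obtain i j i' j' where ij: "p = (i, j)" "p' = (i', j')" by fastforce
      \<comment> \<open>Since \<open>\<sigma> * \<sigma> = 1\<close>, factoring out
        \<open>\<sigma>\<close> puts the larger term \<open>d j\<close> first without changing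
        distances.\<close>
      have "e / 2 \<le> \<bar>(d j + \<sigma> * b i) - (d j' + \<sigma> * b i')\<bar>"
        using p unfolding ij by (intro pair_gap[OF d b \<sigma>]) (auto simp: H_def X_def Y_def)
      moreover have "f p - f p' = \<sigma> * ((d j + \<sigma> * b i) - (d j' + \<sigma> * b i'))"
        using \<sigma> by (auto simp: f_def ij)
      moreover have "\<bar>\<sigma>\<bar> = 1" using \<sigma> by auto
      ultimately show "e / 2 \<le> \<bar>f p - f p'\<bar>" by (simp only: abs_mult mult_1)
    qed
  qed
qed

section \<open>Reduction to ratio 1/16 and linear growth of the counting functions\<close>

text \<open>Every \<open>k\<close>-th term is kept, where \<open>q ^ k \<le> 1 / 16\<close>. As
  \<open>b\<close> decreases, an index \<open>i\<close> counted for \<open>b\<close> has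
  \<open>i div k\<close> counted for the subsequence, and each quotient comes from only
  \<open>k\<close> indices.\<close>

lemma lacunary_sparsify:
  assumes "lacunary b"
  obtains k where "0 < k" "lacunary_with_ratio (1/16) (\<lambda>i. b (k * i))"
    "\<And>W. counting b W \<le> k * counting (\<lambda>i. b (k * i)) W"
proof -
  obtain q where q: "0 < q" "q < 1" and pos: "\<And>i. 0 < b i" and step: "\<And>i. b (Suc i) \<le> q * b i"
    and bq: "lacunary_with_ratio q b"
    using assms unfolding lacunary_def lacunary_with_ratio_def by blast
  obtain k0 where k0: "q ^ k0 < 1 / 16" using real_arch_pow_inv[of "1/16" q] q by auto
  define k where "k = Suc k0"
  have qk: "q ^ k \<le> 1 / 16"
    unfolding k_def power_Suc using k0 q mult_left_le_one_le[of "q ^ k0" q] zero_le_power[of q k0] by linarith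
  have pow: "b (i + j) \<le> q ^ j * b i" for i j
  proof (induction j)
    case (Suc j)
    have "b (i + Suc j) \<le> q * b (i + j)" using step[of "i + j"] by simp
    also have "\<dots> \<le> q * (q ^ j * b i)" using Suc q by (intro mult_left_mono) auto
    finally show ?case by (simp add: mult.assoc)
  qed simp
  have lac: "lacunary_with_ratio (1/16) (\<lambda>i. b (k * i))"
  proof -
    have "b (k * Suc i) \<le> 1 / 16 * b (k * i)" for i
      using pow[of "k * i" k] mult_right_mono[OF qk less_imp_le[OF pos[of "k * i"]]] by (simp add: add.commute)
    then show ?thesis using pos unfolding lacunary_with_ratio_def by simp
  qed
  have "counting b W \<le> k * counting (\<lambda>i. b (k * i)) W" for W
  proof -
    define S where "S = {i. exp (- W) \<le> b (k * i)}"
    have finS: "finite S" using lacunary_finite_counting[of "\<lambda>i. b (k * i)" W] lac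
      unfolding S_def lacunary_def by blast
    have "{i. exp (- W) \<le> b i} \<subseteq> (\<Union>r<k. (\<lambda>j. k * j + r) ` S)"
    proof
      fix i assume i: "i \<in> {i. exp (- W) \<le> b i}"
      have "b i \<le> b (k * (i div k))"
        using lacunary_antimono[OF bq] by (rule antimonoD) simp
      then have "i div k \<in> S" using i unfolding S_def by simp
      then have "k * (i div k) + i mod k \<in> (\<lambda>j. k * j + i mod k) ` S" by blast
      moreover have "i mod k < k" by (simp add: k_def)
      ultimately show "i \<in> (\<Union>r<k. (\<lambda>j. k * j + r) ` S)" by (intro UN_I[of "i mod k"]) simp_all
    qed
    then have "counting b W \<le> card (\<Union>r<k. (\<lambda>j. k * j + r) ` S)"
      unfolding counting_def using finS by (intro card_mono) auto
    also have "\<dots> \<le> (\<Sum>r<k. card ((\<lambda>j. k * j + r) ` S))" by (rule card_UN_le) simp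
    also have "\<dots> \<le> (\<Sum>r<k. card S)" using finS by (intro sum_mono card_image_le)
    finally show ?thesis by (simp add: counting_def S_def)
  qed
  then show ?thesis using that[of k] lac by (simp add: k_def)
qed

text \<open>The ratio \<open>1 / 16\<close> is below \<open>exp (- 1)\<close>, so
  \<open>ln (b i) \<le> ln (b 0) - i\<close>, and a counted index is at most
  \<open>W + ln (b 0)\<close>. Allowing for the index 0, the count is at most \<open>2 * W\<close>
  once \<open>W \<ge> \<bar>ln (b 0)\<bar> + 1\<close>.\<close>

lemma eventually_counting_le:
  assumes b: "lacunary_with_ratio (1/16) b"
  shows "eventually (\<lambda>W. real (counting b W) \<le> 2 * W) at_top"
  unfolding eventually_at_top_linorder
proof (intro exI allI impI)
  fix W assume W: "\<bar>ln (b 0)\<bar> + 1 \<le> W"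
  have pos: "\<And>i. 0 < b i" and step: "\<And>i. b (Suc i) \<le> 1 / 16 * b i"
    using b unfolding lacunary_with_ratio_def by auto
  have ln_le: "ln (b i) \<le> ln (b 0) - real i" for i
  proof (induction i)
    case (Suc i)
    have "exp 1 \<le> (16::real)" using exp_le by linarith
    then have "b (Suc i) * exp 1 \<le> b (Suc i) * 16" using less_imp_le[OF pos] by (rule mult_left_mono)
    then have "b (Suc i) * exp 1 \<le> b i" using step[of i] by linarith
    then have "ln (b (Suc i) * exp 1) \<le> ln (b i)" using pos by simp
    then show ?case using Suc pos[of "Suc i"] by (simp add: ln_mult)
  qed simp
  have "{i. exp (- W) \<le> b i} \<subseteq> {..nat \<lfloor>W + ln (b 0)\<rfloor>}"
  proof
    fix i assume "i \<in> {i. exp (- W) \<le> b i}"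
    then have "- W \<le> ln (b i)" using pos[of i] by (simp add: ln_ge_iff)
    then have "real i \<le> W + ln (b 0)" using ln_le[of i] by linarith
    then show "i \<in> {..nat \<lfloor>W + ln (b 0)\<rfloor>}" by (simp add: le_nat_floor)
  qed
  then have "counting b W \<le> card {..nat \<lfloor>W + ln (b 0)\<rfloor>}"
    unfolding counting_def by (intro card_mono) auto
  then show "real (counting b W) \<le> 2 * W" using W by simp linarith
qed

theorem theorem1:
  fixes S\<^sub>1 S\<^sub>2 :: "real set" and b d :: "nat \<Rightarrow> real"
  assumes "lacunary b" and "lacunary d"
    and "\<And>i. b i \<in> S\<^sub>1" and "\<And>j. d j \<in> S\<^sub>2"
    and "Limsup at_top
           (\<lambda>W::real. ereal (real (counting b W) * real (counting d W) / W)) = \<infinity>"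
  shows "\<not> measure_universal {s\<^sub>1 + s\<^sub>2 | s\<^sub>1 s\<^sub>2. s\<^sub>1 \<in> S\<^sub>1 \<and> s\<^sub>2 \<in> S\<^sub>2}
       \<and> \<not> measure_universal {s\<^sub>1 - s\<^sub>2 | s\<^sub>1 s\<^sub>2. s\<^sub>1 \<in> S\<^sub>1 \<and> s\<^sub>2 \<in> S\<^sub>2}"
proof -
  obtain k where k: "0 < k" "lacunary_with_ratio (1/16) (\<lambda>i. b (k * i))"
    "\<And>W. counting b W \<le> k * counting (\<lambda>i. b (k * i)) W"
    using lacunary_sparsify[OF assms(1)] by metis
  obtain l where l: "0 < l" "lacunary_with_ratio (1/16) (\<lambda>i. d (l * i))"
    "\<And>W. counting d W \<le> l * counting (\<lambda>i. d (l * i)) W"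
    using lacunary_sparsify[OF assms(2)] by metis
  define b' where "b' = (\<lambda>i. b (k * i))"
  define d' where "d' = (\<lambda>i. d (l * i))"
  have many: "\<exists>W\<ge>1. real (counting b' W) \<le> 2 * W \<and> K * W \<le> real (counting b' W) * real (counting d' W)" for K
  proof -
    have ev: "eventually (\<lambda>W. 1 \<le> W \<and> real (counting b' W) \<le> 2 * W) at_top"
      using eventually_conj[OF eventually_ge_at_top eventually_counting_le[OF k(2)]] by (simp add: b'_def)
    \<comment> \<open>An infinite limsup makes the quotient exceed any real bound for arbitrarily
      large \<open>W\<close>, where the eventual conditions \<open>ev\<close> hold too. The factor
      \<open>k * l\<close> in the bound compensates for the passage to subsequences.\<close>
    have "\<not> eventually (\<lambda>W. ereal (real (counting b W) * real (counting d W) / W) \<le> ereal (k * l * K)) at_top"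
      using assms(5) Limsup_bounded[of "\<lambda>W. ereal (real (counting b W) * real (counting d W) / W)"
          "ereal (k * l * K)" at_top]
      by auto
    then have "frequently (\<lambda>W. k * l * K < real (counting b W) * real (counting d W) / W) at_top"
      by (simp add: not_eventually not_le)
    then have "frequently (\<lambda>W. (1 \<le> W \<and> real (counting b' W) \<le> 2 * W) \<and>
        k * l * K < real (counting b W) * real (counting d W) / W) at_top"
      using ev by (rule frequently_eventually_conj)
    then obtain W where W: "1 \<le> W" "real (counting b' W) \<le> 2 * W"
        "k * l * K < real (counting b W) * real (counting d W) / W"
      using frequently_ex by blast
    have "counting b W * counting d W \<le> (k * counting b' W) * (l * counting d' W)"
      using k(3) l(3) unfolding b'_def d'_def by (rule mult_le_mono)
    then have "real (counting b W) * real (counting d W) \<le> (k * l) * (real (counting b' W) * real (counting d' W))"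
      by (metis (mono_tags, opaque_lifting) mult.assoc mult.left_commute of_nat_le_iff of_nat_mult)
    moreover have "(k * l) * (K * W) \<le> real (counting b W) * real (counting d W)"
      using W(1,3) by (simp add: field_simps)
    ultimately have "real (k * l) * (K * W) \<le> real (k * l) * (real (counting b' W) * real (counting d' W))"
      by (simp add: mult.assoc)
    then have "K * W \<le> real (counting b' W) * real (counting d' W)"
      using k(1) l(1) by (subst (asm) mult_le_cancel_left_pos) auto
    then show ?thesis using W by blast
  qed
  \<comment> \<open>The sign \<open>\<sigma>\<close> treats sums and differences at once.\<close>
  have main: "\<not> measure_universal E" if "\<sigma> = 1 \<or> \<sigma> = - 1" "\<And>i j. b i + \<sigma> * d j \<in> E" for \<sigma> E
  proof -
    have b0d0: "0 < b 0" "0 < d 0"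
      using assms(1,2) unfolding lacunary_def lacunary_with_ratio_def by auto
    have "0 \<le> b' 0 + d' 0"
      using b0d0 by (simp add: b'_def d'_def)
    moreover have "has_separated_subsets E (b' 0 + d' 0)"
    proof (rule lacunary_combination_separated[OF _ _ that(1) _ many])
      show "lacunary_with_ratio (1/16) b'" "lacunary_with_ratio (1/16) d'"
        using k(2) l(2) by (simp_all add: b'_def d'_def)
    qed (simp add: b'_def d'_def that(2))
    ultimately show ?thesis by (intro has_separated_subsets_not_universal)
  qed
  have "\<not> measure_universal {s\<^sub>1 + s\<^sub>2 | s\<^sub>1 s\<^sub>2. s\<^sub>1 \<in> S\<^sub>1 \<and> s\<^sub>2 \<in> S\<^sub>2}"
    by (rule main[of 1]) (use assms(3,4) in auto)
  moreover have "\<not> measure_universal {s\<^sub>1 - s\<^sub>2 | s\<^sub>1 s\<^sub>2. s\<^sub>1 \<in> S\<^sub>1 \<and> s\<^sub>2 \<in> S\<^sub>2}"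
    by (rule main[of "- 1"]) (use assms(3,4) in auto)
  ultimately show ?thesis ..
qed

end
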